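(* Let $V$ be a finite set with $n=|V|$ and let $d\le 3$ be a nonnegative integer. Given value-oracle access to a posimodular function $f:2^V\to\{0,1,\dots,d\}$ with $f(\emptyset)=0$, a nonempty subset $X^*\subseteq V$ with $f(X^* )=\min\{f(X)\mid \emptyset\neq X\subseteq V\}$ (and the value $f(X^* )$) can be computed in $O(n^2T_f)$ time.
   Context: A set function $f:2^V\to\mathbb{R}$ is posimodular if $f(X)+f(Y)\ge f(X\setminus Y)+f(Y\setminus X)$ for all $X,Y\subseteq V$. $T_f$ denotes the time needed to evaluate $f(X)$ for a given $X\subseteq V$. *)

theory Defs
  imports Complex_Main
begin

definition posimodular :: "'a set \<Rightarrow> ('a set \<Rightarrow> real) \<Rightarrow> bool" where
  "posimodular V f \<longleftrightarrow>
    (\<forall>X Y. X \<subseteq> V \<longrightarrow> Y \<subseteq> V \<longrightarrow> f X + f Y \<ge> f (X - Y) + f (Y - X))"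

text \<open>
  The machine model is a random access machine with a value oracle, presented as a
  structured language with finitely many named scalars and named arrays of natural numbers.
  The only arithmetic is increment and decrement, so after \<open>t\<close> steps every stored number is
  at most \<open>t\<close> plus the largest of \<open>n\<close>, the constants of the program and the oracle values.
  Hence unit cost is justified: no information can be packed into huge numbers.
\<close>

type_synonym name = string

datatype atom = Const nat | Var name

datatype test = Less atom atom | Equal atom atom

datatype com =
    Skip
  | Assign name atom
  | Incr name
  | Decr name
  | Load name name atom
  | Store name atom atom
  | Query name name
  | Seq com com
  | Cond test com com
  | While test com

record state =
  scalar :: "name \<Rightarrow> nat"
  arr :: "name \<Rightarrow> nat \<Rightarrow> nat"

fun val :: "state \<Rightarrow> atom \<Rightarrow> nat" where
  "val s (Const k) = k"
| "val s (Var x) = scalar s x"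

fun holds :: "state \<Rightarrow> test \<Rightarrow> bool" where
  "holds s (Less a b) \<longleftrightarrow> val s a < val s b"
| "holds s (Equal a b) \<longleftrightarrow> val s a = val s b"

definition set_scalar :: "name \<Rightarrow> nat \<Rightarrow> state \<Rightarrow> state" where
  "set_scalar x k s = s\<lparr>scalar := (scalar s)(x := k)\<rparr>"

definition set_cell :: "name \<Rightarrow> nat \<Rightarrow> nat \<Rightarrow> state \<Rightarrow> state" where
  "set_cell a i k s = s\<lparr>arr := (arr s)(a := (arr s a)(i := k))\<rparr>"

text \<open>The first \<open>n\<close> cells of an array, read as the characteristic vector of a set of indices.\<close>

definition index_set :: "nat \<Rightarrow> state \<Rightarrow> name \<Rightarrow> nat set" where
  "index_set n s a = {i. i < n \<and> arr s a i \<noteq> 0}"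

text \<open>
  \<open>exec n g T c s t s'\<close>: with oracle \<open>g\<close> for sets of indices below \<open>n\<close>, command \<open>c\<close> started
  in \<open>s\<close> terminates in \<open>s'\<close> after exactly \<open>t\<close> time units. An oracle call takes \<open>T\<close> units;
  every other elementary command and every evaluation of a test takes one.
\<close>

inductive exec ::
  "nat \<Rightarrow> (nat set \<Rightarrow> nat) \<Rightarrow> nat \<Rightarrow> com \<Rightarrow> state \<Rightarrow> nat \<Rightarrow> state \<Rightarrow> bool"
  for n :: nat and g :: "nat set \<Rightarrow> nat" and T :: nat where
  Skip: "exec n g T Skip s 1 s"
| Assign: "exec n g T (Assign x a) s 1 (set_scalar x (val s a) s)"
| Incr: "exec n g T (Incr x) s 1 (set_scalar x (scalar s x + 1) s)"
| Decr: "exec n g T (Decr x) s 1 (set_scalar x (scalar s x - 1) s)"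
| Load: "exec n g T (Load x a i) s 1 (set_scalar x (arr s a (val s i)) s)"
| Store: "exec n g T (Store a i b) s 1 (set_cell a (val s i) (val s b) s)"
| Query: "exec n g T (Query x a) s T (set_scalar x (g (index_set n s a)) s)"
| Seq: "exec n g T c1 s t1 s' \<Longrightarrow> exec n g T c2 s' t2 s''
    \<Longrightarrow> exec n g T (Seq c1 c2) s (t1 + t2) s''"
| CondTrue: "holds s b \<Longrightarrow> exec n g T c1 s t s' \<Longrightarrow> exec n g T (Cond b c1 c2) s (1 + t) s'"
| CondFalse: "\<not> holds s b \<Longrightarrow> exec n g T c2 s t s' \<Longrightarrow> exec n g T (Cond b c1 c2) s (1 + t) s'"
| WhileFalse: "\<not> holds s b \<Longrightarrow> exec n g T (While b c) s 1 s"
| WhileTrue: "holds s b \<Longrightarrow> exec n g T c s t1 s' \<Longrightarrow> exec n g T (While b c) s' t2 s''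
    \<Longrightarrow> exec n g T (While b c) s (1 + t1 + t2) s''"

inductive_cases SkipE: "exec n g T Skip s t s'"
inductive_cases AssignE: "exec n g T (Assign x a) s t s'"
inductive_cases IncrE: "exec n g T (Incr x) s t s'"
inductive_cases DecrE: "exec n g T (Decr x) s t s'"
inductive_cases LoadE: "exec n g T (Load x a i) s t s'"
inductive_cases StoreE: "exec n g T (Store a i b) s t s'"
inductive_cases QueryE: "exec n g T (Query x a) s t s'"
inductive_cases SeqE: "exec n g T (Seq c1 c2) s t s'"
inductive_cases CondE: "exec n g T (Cond b c1 c2) s t s'"
inductive_cases WhileE: "exec n g T (While b c) s t s'"

lemma exec_deterministic:
  "exec n g T c s t s' \<Longrightarrow> exec n g T c s u s'' \<Longrightarrow> u = t \<and> s'' = s'"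
proof (induction arbitrary: u s'' rule: exec.induct)
  case (Skip s)
  then show ?case by (rule SkipE) simp
next
  case (Assign x a s)
  then show ?case by (rule AssignE) simp
next
  case (Incr x s)
  then show ?case by (rule IncrE) simp
next
  case (Decr x s)
  then show ?case by (rule DecrE) simp
next
  case (Load x a i s)
  then show ?case by (rule LoadE) simp
next
  case (Store a i b s)
  then show ?case by (rule StoreE) simp
next
  case (Query x a s)
  then show ?case by (rule QueryE) simp
next
  case (Seq c1 s t1 s' c2 t2 r)
  show ?case
    by (rule SeqE[OF Seq.prems]) (metis Seq.IH)
next
  case (CondTrue s b c1 t s' c2)
  show ?case
    by (rule CondE[OF CondTrue.prems]) (metis CondTrue.IH CondTrue.hyps(1) plus_1_eq_Suc)+
next
  case (CondFalse s b c2 t s' c1)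
  show ?case
    by (rule CondE[OF CondFalse.prems]) (metis CondFalse.IH CondFalse.hyps(1) plus_1_eq_Suc)+
next
  case (WhileFalse s b c)
  show ?case
    by (rule WhileE[OF WhileFalse.prems]) (use WhileFalse.hyps in simp_all)
next
  case (WhileTrue s b c t1 s' t2 r)
  show ?case
    by (rule WhileE[OF WhileTrue.prems]) (metis WhileTrue.IH WhileTrue.hyps(1) plus_1_eq_Suc add_Suc)+
qed

text \<open>Initially the memory is zero, except that the scalar \<open>n\<close> holds the size of the ground set.\<close>

definition init :: "nat \<Rightarrow> state" where
  "init n = \<lparr>scalar = (\<lambda>_. 0)(''n'' := n), arr = (\<lambda>_ _. 0)\<rparr>"

text \<open>
  The ground set \<open>V\<close> is presented to the machine through an enumeration \<open>e\<close> of its elements.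
  The run leaves a minimizer in the array \<open>X\<close> and the minimum in the scalar \<open>value\<close>.
\<close>

definition minimizes_within ::
  "com \<Rightarrow> 'a set \<Rightarrow> (nat \<Rightarrow> 'a) \<Rightarrow> ('a set \<Rightarrow> nat) \<Rightarrow> nat \<Rightarrow> nat \<Rightarrow> bool" where
  "minimizes_within P V e f T B \<longleftrightarrow>
    (\<exists>t s Xmin. exec (card V) (\<lambda>I. f (e ` I)) T P (init (card V)) t s \<and> t \<le> B
      \<and> Xmin = e ` index_set (card V) s ''X''
      \<and> Xmin \<noteq> {} \<and> Xmin \<subseteq> V
      \<and> f Xmin = Min {f X | X. X \<noteq> {} \<and> X \<subseteq> V}
      \<and> scalar s ''value'' = f Xmin)"

end

theory Submission imports Defs begin

text \<open>
  Let \<open>X\<close> be an inclusion-minimal minimizer, \<open>k = f X\<close>, and suppose that \<open>X \<noteq> V\<close> and that no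
  singleton has value \<open>\<le> k\<close>. For nonempty \<open>A \<subset> X\<close> and \<open>Z \<subseteq> V - X\<close>, posimodularity of \<open>X\<close> and
  \<open>A \<union> Z\<close> gives \<open>f (X - A) + f Z \<le> k + f (A \<union> Z) \<le> k + 3\<close>, whence \<open>k \<le> 1\<close>.
  For \<open>k = 1\<close>, pairs have value at most 2 inside \<open>X\<close> and 3 across its boundary.
  For \<open>k = 0\<close>, pairs across the boundary have value at least 2; moreover either all subsets of
  \<open>X\<close> have value at most 1, or some \<open>A \<subset> X\<close> has value at least 2, and then all subsets of \<open>V - X\<close>
  have value at most 1. So \<open>X\<close> or its complement is the closed neighbourhood of a vertex in the
  graph of the pairs of value below 2 or 3, and it suffices to evaluate all these neighbourhoods.
\<close>

section \<open>Minimizers as closed neighbourhoods in graphs of cheap pairs\<close>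

definition neighbourhood :: "'a set \<Rightarrow> ('a set \<Rightarrow> nat) \<Rightarrow> nat \<Rightarrow> bool \<Rightarrow> 'a \<Rightarrow> 'a set" where
  "neighbourhood V f j b u = {v \<in> V. (v = u \<or> f {u, v} < j) = b}"

text \<open>Threshold 0 yields the singleton of \<open>u\<close>, as no value is below 0, and
  threshold 4 yields \<open>V\<close>, as no value exceeds 3. Threshold 3 serves a minimum of 1, and
  threshold 2 a minimum of 0, where the complement may be the set that is sought.\<close>

abbreviation choices :: "(nat \<times> bool) set" where
  "choices \<equiv> {(0, True), (2, True), (3, True), (4, True), (2, False)}"

lemma posimodular_nat:
  assumes "posimodular V (\<lambda>X. real (f X))" "X \<subseteq> V" "Y \<subseteq> V"
  shows "f (X - Y) + f (Y - X) \<le> f X + f Y"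
  using assms unfolding posimodular_def by (metis of_nat_add of_nat_le_iff)

lemma neighbourhood_minimizes:
  assumes fin: "finite V" and pm: "posimodular V (\<lambda>X. real (f X))"
    and le3: "\<And>X. X \<subseteq> V \<Longrightarrow> f X \<le> 3"
    and Y: "Y \<subseteq> V" "Y \<noteq> {}"
  shows "\<exists>u \<in> V. \<exists>(j, b) \<in> choices.
    neighbourhood V f j b u \<noteq> {} \<and> f (neighbourhood V f j b u) \<le> f Y"
proof -
  define M where "M = {X. X \<subseteq> V \<and> X \<noteq> {} \<and> (\<forall>Z. Z \<subseteq> V \<longrightarrow> Z \<noteq> {} \<longrightarrow> f X \<le> f Z)}"
  obtain X0 where "X0 \<subseteq> V \<and> X0 \<noteq> {}" "\<forall>Z. Z \<subseteq> V \<and> Z \<noteq> {} \<longrightarrow> f X0 \<le> f Z"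
    using ex_has_least_nat[of "\<lambda>X. X \<subseteq> V \<and> X \<noteq> {}" Y f] Y by metis
  then have "X0 \<in> M" by (simp add: M_def)
  moreover have "finite M" by (rule finite_subset[of _ "Pow V"]) (use fin in \<open>auto simp: M_def\<close>)
  ultimately obtain X where "X \<in> M" and Xmin: "\<And>B. B \<in> M \<Longrightarrow> B \<subseteq> X \<Longrightarrow> B = X"
    using finite_has_minimal[of M] by blast
  define k where "k = f X"
  have X: "X \<subseteq> V" "X \<noteq> {}" and k: "\<And>Z. Z \<subseteq> V \<Longrightarrow> Z \<noteq> {} \<Longrightarrow> k \<le> f Z"
    using \<open>X \<in> M\<close> by (auto simp: M_def k_def)
  have sub: "k < f B" if "B \<subset> X" "B \<noteq> {}" for B
  proof (rule ccontr)
    assume "\<not> k < f B"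
    then have "f B \<le> f Z" if "Z \<subseteq> V" "Z \<noteq> {}" for Z
      using k[OF that] by linarith
    then have "B \<in> M" using that X by (simp add: M_def psubset_eq subset_trans[of B X V])
    then show False using Xmin[of B] that by auto
  qed
  \<comment> \<open>Since \<open>k\<close> is at most \<open>f Y\<close>, it suffices to realise
    some set of value \<open>k\<close> as a neighbourhood.\<close>
  have found: ?thesis if "u \<in> V" "neighbourhood V f j b u = Z" "Z \<noteq> {}" "f Z = k"
    "(j, b) \<in> choices" for u j b Z
    using that k[OF Y] by (intro bexI[of _ u] bexI[of _ "(j, b)"]) auto
  show ?thesis
  proof (cases "\<exists>u\<in>V. f {u} \<le> k")
    case True
    then obtain u where u: "u \<in> V" "f {u} \<le> k" by blast
    show ?thesis
      using k[of "{u}"] u by (intro found[of u 0 True "{u}"]) (auto simp: neighbourhood_def)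
  next
    case False
    then have single: "k < f {u}" if "u \<in> V" for u using that by auto
    show ?thesis
    proof (cases "X = V")
      case True
      obtain u where u: "u \<in> V" using X by auto
      have "f {u, v} < 4" if "v \<in> V" for v
        using le3[of "{u, v}"] u that by auto
      then have "neighbourhood V f 4 True u = V" by (auto simp: neighbourhood_def)
      then show ?thesis using u True by (intro found[of u 4 True V]) (auto simp: k_def)
    next
      case False
      then obtain z where z: "z \<in> V" "z \<notin> X" using X by auto
      have cross: "f (X - A) + f Z \<le> k + f (A \<union> Z)" if "A \<subseteq> X" "Z \<subseteq> V - X" for A Z
      proof -
        have "X - (A \<union> Z) = X - A" "(A \<union> Z) - X = Z" using that by auto
        moreover have "A \<union> Z \<subseteq> V" using that X by auto
        ultimately show ?thesis using posimodular_nat[OF pm X(1), of "A \<union> Z"] by (simp add: k_def)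
      qed
      \<comment> \<open>Apply \<open>cross\<close> to \<open>X - A\<close>, whose complement in
        \<open>X\<close> is \<open>A\<close>, and bound the value of the union by 3.\<close>
      have ub: "f A + f Z \<le> k + 3" if "A \<subseteq> X" "Z \<subseteq> V - X" for A Z
      proof -
        have "X - (X - A) = A" "(X - A) \<union> Z \<subseteq> V" using that X by auto
        then show ?thesis using cross[of "X - A" Z] le3[of "X - A \<union> Z"] that by simp
      qed
      have cross_pair: "f (X - {v}) + f {w} \<le> k + f {v, w}" if "v \<in> X" "w \<in> V" "w \<notin> X" for v w
        using cross[of "{v}" "{w}"] that by (simp add: insert_commute)
      have minus: "k < f (X - {u})" if "u \<in> X" for u
      proof -
        \<comment> \<open>A singleton \<open>X\<close> would contradict \<open>single\<close>, so
          \<open>X - {u}\<close> is a nonempty proper subset of \<open>X\<close>.\<close>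
        have "X \<noteq> {u}" using single[of u] that X by (auto simp: k_def)
        then show ?thesis using that by (intro sub) auto
      qed
      obtain u where u: "u \<in> X" using X by auto
      have fz: "k < f {z}" using single z by auto
      \<comment> \<open>Both singletons have value at least k + 1, hence 2k + 2 <= k + 3.\<close>
      have "k \<le> 1" using ub[of "{u}" "{z}"] single[of u] fz u z X by force
      then consider "k = 1" | "k = 0" by linarith
      then show ?thesis
      proof cases
        case 1
        \<comment> \<open>Now \<open>f {z}\<close> is at least 2, so \<open>ub\<close> leaves at
          most 2 for a pair inside \<open>X\<close>. Across the boundary, \<open>X - {u}\<close> and
          \<open>{v}\<close> both have value at least 2, which forces 3 on the pair.\<close>
        have "f {u, v} < 3" if "v \<in> X" for v
          using ub[of "{u, v}" "{z}"] that u z fz 1 by auto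
        moreover have "\<not> f {u, v} < 3" if "v \<in> V" "v \<notin> X" for v
          using cross_pair[OF u that] minus[OF u] single[OF that(1)] 1 by linarith
        ultimately have "neighbourhood V f 3 True u = X"
          using u X by (auto simp: neighbourhood_def)
        then show ?thesis using u X by (intro found[of u 3 True X]) (auto simp: k_def)
      next
        case 2
        have across: "\<not> f {v, w} < 2" if "v \<in> X" "w \<in> V" "w \<notin> X" for v w
          using cross_pair[OF that] minus[OF that(1)] single[OF that(2)] 2 by linarith
        show ?thesis
        \<comment> \<open>With k = 0, \<open>ub\<close> forbids values of 2 or more on both sides of
          the boundary at once. If they occur inside \<open>X\<close>, the pairs within
          \<open>V - X\<close> are the cheap ones, and \<open>X\<close> is the complement of the
          closed neighbourhood of \<open>z\<close>.\<close>
        proof (cases "\<exists>A \<subseteq> X. 2 \<le> f A")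
          case False
          then have "f {u, v} < 2" if "v \<in> X" for v
            using that u by (meson empty_subsetI insert_subset not_less)
          then have "neighbourhood V f 2 True u = X"
            using u X across[OF u] by (auto simp: neighbourhood_def)
          then show ?thesis using u X by (intro found[of u 2 True X]) (auto simp: k_def)
        next
          case True
          then obtain A where A: "A \<subseteq> X" "2 \<le> f A" by blast
          have "f {z, w} < 2" if "w \<in> V" "w \<notin> X" for w
            using ub[of A "{z, w}"] A that z 2 by auto
          moreover have "\<not> f {z, w} < 2" if "w \<in> X" for w
            using across[of w z] that z by (simp add: insert_commute)
          ultimately have "neighbourhood V f 2 False z = X"
            using z X by (auto simp: neighbourhood_def)
          then show ?thesis using z X by (intro found[of z 2 False X]) (auto simp: k_def)
        qed
      qed
    qed
  qed
qed

section \<open>Weakest preconditions with running time\<close>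

definition runs ::
  "nat \<Rightarrow> (nat set \<Rightarrow> nat) \<Rightarrow> nat \<Rightarrow> com \<Rightarrow> state \<Rightarrow> (nat \<Rightarrow> state \<Rightarrow> bool) \<Rightarrow> bool" where
  "runs n g T c s Q \<longleftrightarrow> (\<exists>t s'. exec n g T c s t s' \<and> Q t s')"

lemma runs_mono:
  "runs n g T c s Q \<Longrightarrow> (\<And>t s'. Q t s' \<Longrightarrow> R t s') \<Longrightarrow> runs n g T c s R"
  unfolding runs_def by blast

lemma runs_Skip: "runs n g T Skip s Q \<longleftrightarrow> Q 1 s"
  unfolding runs_def by (metis SkipE exec.Skip)

lemma runs_Assign: "runs n g T (Assign x a) s Q \<longleftrightarrow> Q 1 (set_scalar x (val s a) s)"
  unfolding runs_def by (metis AssignE exec.Assign)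

lemma runs_Incr: "runs n g T (Incr x) s Q \<longleftrightarrow> Q 1 (set_scalar x (scalar s x + 1) s)"
  unfolding runs_def by (metis IncrE exec.Incr)

lemma runs_Load: "runs n g T (Load x y a) s Q \<longleftrightarrow> Q 1 (set_scalar x (arr s y (val s a)) s)"
  unfolding runs_def by (metis LoadE exec.Load)

lemma runs_Store: "runs n g T (Store x a b) s Q \<longleftrightarrow> Q 1 (set_cell x (val s a) (val s b) s)"
  unfolding runs_def by (metis StoreE exec.Store)

lemma runs_Query: "runs n g T (Query x y) s Q \<longleftrightarrow> Q T (set_scalar x (g (index_set n s y)) s)"
  unfolding runs_def by (metis QueryE exec.Query)

text \<open>The requirement on the second command becomes the postcondition of the first, with the
  elapsed time added. As simp rules, these equivalences execute loop-free code symbolically and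
  total its cost.\<close>

lemma runs_Seq:
  "runs n g T (Seq c1 c2) s Q \<longleftrightarrow>
    runs n g T c1 s (\<lambda>t1 s'. runs n g T c2 s' (\<lambda>t2. Q (t1 + t2)))"
  unfolding runs_def by (metis SeqE exec.Seq)

lemma runs_Cond:
  "runs n g T (Cond p c1 c2) s Q \<longleftrightarrow>
    (if holds s p then runs n g T c1 s (\<lambda>t. Q (1 + t)) else runs n g T c2 s (\<lambda>t. Q (1 + t)))"
proof (cases "holds s p")
  case True
  then have "exec n g T (Cond p c1 c2) s t s' \<longleftrightarrow> (\<exists>u. t = 1 + u \<and> exec n g T c1 s u s')" for t s'
    using exec.CondTrue[OF True] by (auto elim: CondE)
  with True show ?thesis by (auto simp: runs_def)
next
  case False
  then have "exec n g T (Cond p c1 c2) s t s' \<longleftrightarrow> (\<exists>u. t = 1 + u \<and> exec n g T c2 s u s')" for t s'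
    using exec.CondFalse[OF False] by (auto elim: CondE)
  with False show ?thesis by (auto simp: runs_def)
qed

lemmas runs_simps [simp] =
  runs_Skip runs_Assign runs_Incr runs_Load runs_Store runs_Query runs_Seq runs_Cond

text \<open>The invariant is indexed by the counter, so re-establishing it at \<open>Suc i\<close>
  includes having incremented \<open>x\<close>. Each round costs \<open>K\<close> plus one test; the
  last 1 pays for the failing test.\<close>

lemma runs_for:
  assumes head: "\<And>i s. I i s \<Longrightarrow> scalar s x = i \<and> scalar s ''n'' = N"
    and step: "\<And>i s. i < N \<Longrightarrow> I i s \<Longrightarrow> runs n g T c s (\<lambda>t s'. t \<le> K \<and> I (Suc i) s')"
    and start: "I 0 s"
  shows "runs n g T (While (Less (Var x) (Var ''n'')) c) s
    (\<lambda>t s'. t \<le> N * (K + 1) + 1 \<and> I N s')"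
proof -
  \<comment> \<open>Generalised to any start \<open>i\<close>, for induction on the number of rounds
    left.\<close>
  have "i \<le> N \<Longrightarrow> I i s \<Longrightarrow> \<exists>t s'. exec n g T (While (Less (Var x) (Var ''n'')) c) s t s'
    \<and> t \<le> (N - i) * (K + 1) + 1 \<and> I N s'" for i s
  proof (induction "N - i" arbitrary: i s)
    case 0
    then have "i = N" by simp
    with head[OF 0(3)] have "\<not> holds s (Less (Var x) (Var ''n''))" by simp
    from exec.WhileFalse[OF this] 0 \<open>i = N\<close> show ?case by fastforce
  next
    case (Suc m)
    then have "i < N" by simp
    with head[OF Suc.prems(2)] have h: "holds s (Less (Var x) (Var ''n''))" by simp
    obtain t s' where 1: "exec n g T c s t s'" "t \<le> K" "I (Suc i) s'"
      using step[OF \<open>i < N\<close> Suc.prems(2)] unfolding runs_def by blast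
    moreover have m: "m = N - Suc i" using Suc.hyps(2) by simp
    ultimately obtain t' s'' where 2: "exec n g T (While (Less (Var x) (Var ''n'')) c) s' t' s''"
      "t' \<le> (N - Suc i) * (K + 1) + 1" "I N s''"
      using Suc.hyps(1)[of "Suc i" s'] \<open>i < N\<close> by auto
    have "N - i = Suc (N - Suc i)" using \<open>i < N\<close> by simp
    then have "1 + t + t' \<le> (N - i) * (K + 1) + 1" using 1(2) 2(2) by simp
    then show ?case using exec.WhileTrue[OF h 1(1) 2(1)] 2(3) by blast
  qed
  from this[of 0 s] start show ?thesis unfolding runs_def by simp
qed

lemma state_simps [simp]:
  "scalar (set_scalar x k s) = (scalar s)(x := k)"
  "arr (set_scalar x k s) = arr s"
  "scalar (set_cell a i k s) = scalar s"
  "arr (set_cell a i k s) = (arr s)(a := (arr s a)(i := k))"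
  by (simp_all add: set_scalar_def set_cell_def)

section \<open>The program and the invariants of its inner loops\<close>

definition test_member :: "nat \<Rightarrow> bool \<Rightarrow> com" where
  "test_member j b =
    Seq (Store ''S'' (Var ''u'') (Const 1)) (
    Seq (Store ''S'' (Var ''v'') (Const 1)) (
    Seq (Query ''p'' ''S'') (
    Seq (Store ''S'' (Var ''u'') (Const 0)) (
    Seq (Store ''S'' (Var ''v'') (Const 0)) (
    Cond (Equal (Var ''v'') (Var ''u''))
      (Assign ''b'' (Const (of_bool b)))
      (Cond (Less (Var ''p'') (Const j))
        (Assign ''b'' (Const (of_bool b)))
        (Assign ''b'' (Const (of_bool (\<not> b))))))))))"

text \<open>The flag \<open>e\<close> records that the collected set is nonempty. With
  \<open>b = False\<close> it may be empty, and the empty set, of value 0, must not compete with the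
  nonempty ones.\<close>

definition collect :: "nat \<Rightarrow> bool \<Rightarrow> com" where
  "collect j b =
    Seq (Assign ''e'' (Const 0)) (
    Seq (Assign ''v'' (Const 0)) (
    While (Less (Var ''v'') (Var ''n'')) (
      Seq (test_member j b) (
      Seq (Store ''C'' (Var ''v'') (Var ''b'')) (
      Seq (Cond (Equal (Var ''b'') (Const 1)) (Assign ''e'' (Const 1)) Skip)
      (Incr ''v''))))))"

definition copy :: com where
  "copy =
    Seq (Assign ''v'' (Const 0)) (
    While (Less (Var ''v'') (Var ''n'')) (
      Seq (Load ''b'' ''C'' (Var ''v'')) (
      Seq (Store ''X'' (Var ''v'') (Var ''b''))
      (Incr ''v''))))"

definition improve :: com where
  "improve =
    Cond (Equal (Var ''e'') (Const 1))
      (Seq (Query ''p'' ''C'')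
        (Cond (Less (Var ''p'') (Var ''value''))
          (Seq (Assign ''value'' (Var ''p'')) copy)
          Skip))
      Skip"

definition examine :: "nat \<Rightarrow> bool \<Rightarrow> com" where
  "examine j b = Seq (collect j b) improve"

definition minimize :: com where
  "minimize =
    Seq (Assign ''value'' (Const 4)) (
    Seq (Assign ''u'' (Const 0)) (
    While (Less (Var ''u'') (Var ''n'')) (
      Seq (examine 0 True) (
      Seq (examine 2 True) (
      Seq (examine 3 True) (
      Seq (examine 4 True) (
      Seq (examine 2 False)
      (Incr ''u''))))))))"

definition frame :: "nat \<Rightarrow> nat \<Rightarrow> nat \<Rightarrow> (nat \<Rightarrow> nat) \<Rightarrow> state \<Rightarrow> bool" where
  "frame n u m X s \<longleftrightarrow> scalar s ''n'' = n \<and> scalar s ''u'' = u \<and> scalar s ''value'' = m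
    \<and> arr s ''S'' = (\<lambda>_. 0) \<and> arr s ''X'' = X"

text \<open>Resetting only the cells \<open>u\<close> and \<open>v\<close> restores the zero array
  demanded by \<open>frame\<close>. A pair query thus has constant overhead; clearing all
  \<open>n\<close> cells each time would make the total cubic.\<close>

lemma runs_test_member:
  assumes "frame n u m X s" "u < n" "scalar s ''v'' = v" "v < n"
  shows "runs n g T (test_member j b) s (\<lambda>t s'. t \<le> 8 + T \<and> frame n u m X s'
    \<and> scalar s' ''v'' = v \<and> scalar s' ''e'' = scalar s ''e'' \<and> arr s' ''C'' = arr s ''C''
    \<and> scalar s' ''b'' = of_bool (v \<in> neighbourhood {..<n} g j b u))"
proof -
  define s1 where "s1 = set_cell ''S'' v 1 (set_cell ''S'' u 1 s)"
  have "index_set n s1 ''S'' = {u, v}"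
    using assms by (auto simp: index_set_def frame_def s1_def)
  \<comment> \<open>This covers \<open>u = v\<close> as well.\<close>
  moreover have "((\<lambda>_. 0)(u := 1, v := 1, u := 0, v := 0)) = (\<lambda>_. 0 :: nat)" by auto
  ultimately show ?thesis
    using assms by (auto simp: test_member_def frame_def neighbourhood_def s1_def)
qed

lemma runs_collect:
  assumes "frame n u m X s" "u < n"
  shows "runs n g T (collect j b) s (\<lambda>t s'. t \<le> n * (T + 13) + 3 \<and> frame n u m X s'
    \<and> index_set n s' ''C'' = neighbourhood {..<n} g j b u
    \<and> (scalar s' ''e'' = 1 \<longleftrightarrow> neighbourhood {..<n} g j b u \<noteq> {}))"
proof -
  let ?N = "neighbourhood {..<n} g j b u"
  define I where "I i s \<longleftrightarrow> frame n u m X s \<and> scalar s ''v'' = i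
    \<and> (\<forall>w<i. arr s ''C'' w \<noteq> 0 \<longleftrightarrow> w \<in> ?N)
    \<and> (scalar s ''e'' = 1 \<longleftrightarrow> (\<exists>w<i. w \<in> ?N))" for i s
  have fin: "t \<le> n * (T + 12 + 1) + 1 \<and> I n s' \<Longrightarrow> 1 + (1 + t) \<le> n * (T + 13) + 3 \<and> frame n u m X s'
    \<and> index_set n s' ''C'' = ?N \<and> (scalar s' ''e'' = 1 \<longleftrightarrow> ?N \<noteq> {})" for t s'
  proof -
    assume *: "t \<le> n * (T + 12 + 1) + 1 \<and> I n s'"
    moreover have "w < n" if "w \<in> ?N" for w using that by (simp add: neighbourhood_def)
    ultimately have "index_set n s' ''C'' = ?N" "scalar s' ''e'' = 1 \<longleftrightarrow> ?N \<noteq> {}"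
      unfolding I_def index_set_def by blast+
    then show ?thesis using * by (simp add: I_def algebra_simps)
  qed
  show ?thesis
    unfolding collect_def runs_simps
  \<comment> \<open>One round: at most T + 8 for the membership test, 1 for the store, 2 for the
    conditional and 1 for the increment.\<close>
  proof (rule runs_mono[OF runs_for[where I = I and N = n and K = "T + 12"] fin], goal_cases)
    case (1 i s)
    then show ?case by (auto simp: I_def frame_def)
  next
    case (2 i s)
    then have I: "frame n u m X s" "scalar s ''v'' = i"
      "\<forall>w<i. arr s ''C'' w \<noteq> 0 \<longleftrightarrow> w \<in> ?N" "scalar s ''e'' = 1 \<longleftrightarrow> (\<exists>w<i. w \<in> ?N)"
      by (auto simp: I_def)
    show ?case
      unfolding runs_simps
      by (rule runs_mono[OF runs_test_member[OF I(1) assms(2) I(2) 2(1)]])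
        (use I in \<open>auto simp: I_def frame_def less_Suc_eq\<close>)
  next
    case 3
    then show ?case using assms by (auto simp: I_def frame_def)
  qed
qed

lemma runs_copy:
  assumes "frame n u m X s"
  shows "runs n g T copy s (\<lambda>t s'. t \<le> n * 4 + 2
    \<and> (\<exists>X'. frame n u m X' s') \<and> index_set n s' ''X'' = index_set n s ''C'')"
proof -
  define I where "I i s' \<longleftrightarrow> (\<exists>X'. frame n u m X' s') \<and> scalar s' ''v'' = i
    \<and> arr s' ''C'' = arr s ''C'' \<and> (\<forall>w<i. arr s' ''X'' w = arr s ''C'' w)" for i s'
  have fin: "t \<le> n * (3 + 1) + 1 \<and> I n s' \<Longrightarrow> 1 + t \<le> n * 4 + 2
    \<and> (\<exists>X'. frame n u m X' s') \<and> index_set n s' ''X'' = index_set n s ''C''" for t s'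
    by (auto simp: I_def index_set_def)
  show ?thesis
    unfolding copy_def runs_simps
  proof (rule runs_mono[OF runs_for[where I = I and N = n and K = 3] fin], goal_cases)
    case (1 i s)
    then show ?case by (auto simp: I_def frame_def)
  next
    case (2 i s)
    then show ?case by (auto simp: I_def frame_def less_Suc_eq)
  next
    case 3
    then show ?case using assms by (auto simp: I_def frame_def)
  qed
qed

text \<open>The value 4, which exceeds all oracle values, marks that no candidate has been recorded.\<close>

definition best :: "nat \<Rightarrow> (nat set \<Rightarrow> nat) \<Rightarrow> nat set set \<Rightarrow> nat \<Rightarrow> state \<Rightarrow> bool" where
  "best n g K u s \<longleftrightarrow> (\<exists>m X. frame n u m X s)
    \<and> (scalar s ''value'' = 4
      \<or> index_set n s ''X'' \<noteq> {} \<and> scalar s ''value'' = g (index_set n s ''X''))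
    \<and> (\<forall>C \<in> K. C \<noteq> {} \<longrightarrow> scalar s ''value'' \<le> g C)"

lemma runs_improve:
  assumes "best n g K u s" "index_set n s ''C'' = C" "scalar s ''e'' = 1 \<longleftrightarrow> C \<noteq> {}"
  shows "runs n g T improve s (\<lambda>t s'. t \<le> n * 4 + T + 5 \<and> best n g (insert C K) u s')"
proof (cases "C \<noteq> {} \<and> g C < scalar s ''value''")
  case True
  \<comment> \<open>The state before copying: \<open>value\<close> is already new while
    \<open>X\<close> still holds the old set, so \<open>best\<close> is available again only after
    the copy.\<close>
  define s1 where "s1 = set_scalar ''value'' (g C) (set_scalar ''p'' (g C) s)"
  from assms(1) obtain X where fr: "frame n u (g C) X s1"
    by (auto simp: best_def frame_def s1_def)
  \<comment> \<open>The offset 3 + T pays for two tests, the query and the assignment.\<close>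
  have "runs n g T copy s1 (\<lambda>t s'. 3 + T + t \<le> n * 4 + T + 5 \<and> best n g (insert C K) u s')"
  proof (rule runs_mono[OF runs_copy[OF fr]])
    fix t s'
    assume *: "t \<le> n * 4 + 2 \<and> (\<exists>X'. frame n u (g C) X' s')
      \<and> index_set n s' ''X'' = index_set n s1 ''C''"
    have "index_set n s1 ''C'' = C" using assms(2) by (simp add: s1_def index_set_def)
    moreover have "scalar s' ''value'' = g C" using * by (auto simp: frame_def)
    ultimately show "3 + T + t \<le> n * 4 + T + 5 \<and> best n g (insert C K) u s'"
      using * assms(1) True unfolding best_def by fastforce
  qed
  then show ?thesis
    using assms True by (simp add: improve_def s1_def)
next
  case False
  then show ?thesis
    using assms by (auto simp: improve_def best_def frame_def index_set_def)
qed

lemma runs_examine: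
  assumes "best n g K u s" "u < n"
  shows "runs n g T (examine j b) s (\<lambda>t s'. t \<le> n * (T + 17) + T + 8
    \<and> best n g (insert (neighbourhood {..<n} g j b u) K) u s')"
proof -
  let ?N = "neighbourhood {..<n} g j b u"
  from assms obtain m X where fr: "frame n u m X s" by (auto simp: best_def)
  show ?thesis
    unfolding examine_def runs_simps
  proof (rule runs_mono[OF runs_collect[OF fr assms(2)]])
    fix t s'
    assume *: "t \<le> n * (T + 13) + 3 \<and> frame n u m X s' \<and> index_set n s' ''C'' = ?N
      \<and> (scalar s' ''e'' = 1 \<longleftrightarrow> ?N \<noteq> {})"
    then have "best n g K u s'"
      using assms(1) fr by (auto simp: best_def frame_def index_set_def)
    from runs_improve[OF this, of ?N T] *
    show "runs n g T improve s' (\<lambda>t2 s'. t + t2 \<le> n * (T + 17) + T + 8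
      \<and> best n g (insert ?N K) u s')"
      by (auto elim!: runs_mono simp: algebra_simps)
  qed
qed

section \<open>The outer loop and the quadratic bound\<close>

definition candidates :: "nat \<Rightarrow> (nat set \<Rightarrow> nat) \<Rightarrow> nat \<Rightarrow> nat set set" where
  "candidates n g i = (\<Union>u<i. (\<lambda>(j, b). neighbourhood {..<n} g j b u) ` choices)"

lemma runs_minimize:
  "runs n g T minimize (init n) (\<lambda>t s. t \<le> n * (5 * (n * (T + 17) + T + 8) + 2) + 3
    \<and> best n g (candidates n g n) n s)"
proof -
  define B where "B = n * (T + 17) + T + 8"
  define I where "I i s \<longleftrightarrow> best n g (candidates n g i) i s" for i s
  have fin: "t \<le> n * (5 * B + 1 + 1) + 1 \<and> I n s \<Longrightarrow> 1 + (1 + t) \<le> n * (5 * B + 2) + 3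
    \<and> best n g (candidates n g n) n s" for t s
    by (auto simp: I_def)
  \<comment> \<open>\<open>runs_examine\<close> with an arbitrary postcondition, so that the five
    examinations can be chained by plain rule application.\<close>
  have cons: "runs n g T (examine j b) s Q"
    if "best n g K u s" "u < n"
      "\<And>t s'. t \<le> B \<Longrightarrow> best n g (insert (neighbourhood {..<n} g j b u) K) u s' \<Longrightarrow> Q t s'"
    for j b K u s Q
    by (rule runs_mono[OF runs_examine[OF that(1,2)]]) (use that(3) in \<open>auto simp: B_def\<close>)
  show ?thesis
    unfolding minimize_def runs_simps B_def[symmetric]
  proof (rule runs_mono[OF runs_for[where I = I and N = n and K = "5 * B + 1"] fin], goal_cases)
    case (1 i s)
    then show ?case by (auto simp: I_def best_def frame_def)
  next
    case (2 i s)
    \<comment> \<open>The five inserted sets are exactly those contributed by vertex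
      \<open>i\<close>, one for each element of \<open>choices\<close>.\<close>
    have step: "best n g (candidates n g (Suc i)) (Suc i) (set_scalar ''u'' (scalar s ''u'' + 1) s)"
      if "best n g (insert (neighbourhood {..<n} g 2 False i)
        (insert (neighbourhood {..<n} g 4 True i) (insert (neighbourhood {..<n} g 3 True i)
        (insert (neighbourhood {..<n} g 2 True i) (insert (neighbourhood {..<n} g 0 True i)
        (candidates n g i)))))) i s" for s
      using that
      by (auto simp: best_def frame_def candidates_def index_set_def lessThan_Suc)
    have b0: "best n g (candidates n g i) i s" using 2 by (simp add: I_def)
    show ?case
      unfolding runs_simps
      apply (rule cons[OF b0 2(1)])
      apply (rule cons[OF _ 2(1)], assumption)+
      using step by (simp add: I_def)
  next
    case 3
    then show ?case
      by (auto simp: I_def best_def frame_def init_def candidates_def)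
  qed
qed

lemma minimize_correct:
  assumes pm: "posimodular {..<n} (\<lambda>I. real (g I))"
    and le3: "\<And>I. I \<subseteq> {..<n} \<Longrightarrow> g I \<le> 3" and "n > 0" "T > 0"
  shows "\<exists>t s. exec n g T minimize (init n) t s \<and> t \<le> 140 * n\<^sup>2 * T
    \<and> index_set n s ''X'' \<noteq> {} \<and> scalar s ''value'' = g (index_set n s ''X'')
    \<and> (\<forall>Y \<subseteq> {..<n}. Y \<noteq> {} \<longrightarrow> scalar s ''value'' \<le> g Y)"
proof -
  obtain t s where ex: "exec n g T minimize (init n) t s"
    and t: "t \<le> n * (5 * (n * (T + 17) + T + 8) + 2) + 3"
    and best: "best n g (candidates n g n) n s"
    using runs_minimize[of n g T] unfolding runs_def by blast
  have le: "scalar s ''value'' \<le> g Y" if Y: "Y \<subseteq> {..<n}" "Y \<noteq> {}" for Y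
  proof -
    obtain u j b where u: "u < n" "(j, b) \<in> choices"
      and N: "neighbourhood {..<n} g j b u \<noteq> {}" "g (neighbourhood {..<n} g j b u) \<le> g Y"
      using neighbourhood_minimizes[OF finite_lessThan pm le3 Y] by auto
    then have "neighbourhood {..<n} g j b u \<in> candidates n g n"
      unfolding candidates_def by force
    then show ?thesis using best N unfolding best_def by force
  qed
  \<comment> \<open>The whole ground set is nonempty and has value at most 3, so some candidate was
    recorded.\<close>
  have "scalar s ''value'' \<noteq> 4"
    using le[OF subset_refl] le3[OF subset_refl] \<open>n > 0\<close> by (auto simp: lessThan_empty_iff)
  then have "index_set n s ''X'' \<noteq> {} \<and> scalar s ''value'' = g (index_set n s ''X'')"
    using best by (auto simp: best_def)
  moreover have "t \<le> 140 * n\<^sup>2 * T"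
  proof -
    \<comment> \<open>Every lower-order term is absorbed into \<open>n * n * T\<close>, and the
      coefficients add up: 5 + 85 + 5 + 42 + 3 = 140.\<close>
    have "n \<le> n * n * T" "n * n \<le> n * n * T" "n * T \<le> n * n * T" "1 \<le> n * n * T"
      using assms by auto
    moreover have "t \<le> 5 * (n * n * T) + 85 * (n * n) + 5 * (n * T) + 42 * n + 3"
      using t by (simp add: algebra_simps)
    ultimately show ?thesis unfolding power2_eq_square mult.assoc by linarith
  qed
  ultimately show ?thesis using ex le by blast
qed

section \<open>Transfer from indices to the ground set\<close>

lemma posimodular_pullback:
  assumes "posimodular V f" "inj_on e U" "e ` U \<subseteq> V"
  shows "posimodular U (\<lambda>I. f (e ` I))"
  unfolding posimodular_def
proof (intro allI impI)
  fix X Y assume XY: "X \<subseteq> U" "Y \<subseteq> U"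
  \<comment> \<open>Images commute with set difference because \<open>e\<close> is injective on
    \<open>U\<close>.\<close>
  then have "e ` (X - Y) = e ` X - e ` Y" "e ` (Y - X) = e ` Y - e ` X"
    using assms(2) by (meson Diff_subset inj_on_image_set_diff subset_trans)+
  moreover have "e ` X \<subseteq> V" "e ` Y \<subseteq> V" using XY assms(3) by auto
  ultimately show "f (e ` (X - Y)) + f (e ` (Y - X)) \<le> f (e ` X) + f (e ` Y)"
    using assms(1) by (simp add: posimodular_def)
qed

theorem theorem3:
  fixes d :: nat
  assumes "d \<le> 3"
  shows "\<exists>(P :: com) (c :: nat). \<forall>(V :: 'a set) (e :: nat \<Rightarrow> 'a) (f :: 'a set \<Rightarrow> nat) (T :: nat).
    finite V \<longrightarrow> V \<noteq> {} \<longrightarrow> bij_betw e {..<card V} V \<longrightarrow>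
    f ` Pow V \<subseteq> {0..d} \<longrightarrow> f {} = 0 \<longrightarrow> posimodular V (\<lambda>X. real (f X)) \<longrightarrow> T \<ge> 1 \<longrightarrow>
    minimizes_within P V e f T (c * (card V)\<^sup>2 * T)"
proof (rule exI[of _ minimize], rule exI[of _ 140], intro allI impI)
  fix V :: "'a set" and e :: "nat \<Rightarrow> 'a" and f :: "'a set \<Rightarrow> nat" and T :: nat
  assume V: "finite V" "V \<noteq> {}" and e: "bij_betw e {..<card V} V"
    and rng: "f ` Pow V \<subseteq> {0..d}" and pm: "posimodular V (\<lambda>X. real (f X))" and T: "T \<ge> 1"
  have img: "e ` {..<card V} = V" and inj: "inj_on e {..<card V}"
    using e by (auto simp: bij_betw_def)
  have le3: "f (e ` I) \<le> 3" if "I \<subseteq> {..<card V}" for I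
  proof -
    have "e ` I \<subseteq> V" using that img by auto
    then have "f (e ` I) \<in> {0..d}" using rng by blast
    then show ?thesis using assms by simp
  qed
  have "card V > 0" using V by (simp add: card_gt_0_iff)
  moreover have "posimodular {..<card V} (\<lambda>I. real (f (e ` I)))"
    using posimodular_pullback[OF pm inj] img by simp
  ultimately have "\<exists>t s. exec (card V) (\<lambda>I. f (e ` I)) T minimize (init (card V)) t s
    \<and> t \<le> 140 * (card V)\<^sup>2 * T \<and> index_set (card V) s ''X'' \<noteq> {}
    \<and> scalar s ''value'' = f (e ` index_set (card V) s ''X'')
    \<and> (\<forall>Y \<subseteq> {..<card V}. Y \<noteq> {} \<longrightarrow> scalar s ''value'' \<le> f (e ` Y))"
    using le3 T by (intro minimize_correct) auto
  then obtain t s where ex: "exec (card V) (\<lambda>I. f (e ` I)) T minimize (init (card V)) t s"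
    and t: "t \<le> 140 * (card V)\<^sup>2 * T" and ne: "index_set (card V) s ''X'' \<noteq> {}"
    and val: "scalar s ''value'' = f (e ` index_set (card V) s ''X'')"
    and le: "\<forall>Y \<subseteq> {..<card V}. Y \<noteq> {} \<longrightarrow> scalar s ''value'' \<le> f (e ` Y)"
    by (elim exE conjE) (rule that)
  define Xm where "Xm = e ` index_set (card V) s ''X''"
  have "index_set (card V) s ''X'' \<subseteq> {..<card V}" by (auto simp: index_set_def)
  then have sub: "Xm \<subseteq> V" using img by (auto simp: Xm_def)
  have "Xm \<noteq> {}" using ne by (simp add: Xm_def)
  have "f Xm = Min {f X | X. X \<noteq> {} \<and> X \<subseteq> V}"
  proof (rule Min_eqI[symmetric])
    have "{f X | X. X \<noteq> {} \<and> X \<subseteq> V} \<subseteq> f ` Pow V" by auto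
    then show "finite {f X | X. X \<noteq> {} \<and> X \<subseteq> V}" using V(1) by (meson finite_Pow_iff finite_imageI finite_subset)
    show "f Xm \<in> {f X | X. X \<noteq> {} \<and> X \<subseteq> V}" using sub \<open>Xm \<noteq> {}\<close> by auto
    fix y assume "y \<in> {f X | X. X \<noteq> {} \<and> X \<subseteq> V}"
    then obtain X where X: "y = f X" "X \<noteq> {}" "X \<subseteq> V" by auto
    \<comment> \<open>Every subset of \<open>V\<close> is the image of a set of indices, so
      minimality over indices carries over.\<close>
    then obtain Y where "Y \<subseteq> {..<card V}" "X = e ` Y" using img by (metis subset_imageE)
    then show "f Xm \<le> y" using le X val by (auto simp: Xm_def)
  qed
  then show "minimizes_within minimize V e f T (140 * (card V)\<^sup>2 * T)"
    unfolding minimizes_within_def using ex t val sub \<open>Xm \<noteq> {}\<close> Xm_def by blast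
qed

end
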